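(* Let $f$ be a transcendental entire function and let $R>0$ be such that $M(r,f)>r$ for all $r\ge R$. For $n\in\mathbb N$ let $$R_n=M^n(R)\quad\text{and}\quad \varepsilon_n=\max_{R_n\le r\le R_{n+1}}\frac{\log\log M(r)}{\log r}.$$ If $\sum_{n\in\mathbb N}\varepsilon_n<\infty$, then $A_R(f)$ is a spider's web.
   Context: For an entire function $f$, $M(r)=M(r,f)=\max_{|z|=r}|f(z)|$, and $M^n(r)$ denotes the $n$th iterate of the function $r\mapsto M(r)$; $f^n$ denotes the $n$th iterate of $f$. For $R>0$ with $M(r)>r$ for $r\ge R$, $$A_R(f)=\{z\in\mathbb C: |f^n(z)|\ge M^n(R)\text{ for all } n\in\mathbb N\}.$$ A set $E\subset\mathbb C$ is a spider's web if $E$ is connected and there exists a sequence of bounded simply connected domains $G_n$ with $\partial G_n\subset E$, $G_n\subset G_{n+1}$ for all $n\in\mathbb N$, and $\bigcup_{n\in\mathbb N}G_n=\mathbb C$. *)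

theory Defs
  imports "HOL-Analysis.Analysis" "HOL-Computational_Algebra.Polynomial"
begin

definition transcendental_entire :: "(complex \<Rightarrow> complex) \<Rightarrow> bool" where
  "transcendental_entire f \<longleftrightarrow> f holomorphic_on UNIV \<and> \<not> (\<exists>p :: complex poly. \<forall>z. f z = poly p z)"

definition max_mod :: "(complex \<Rightarrow> complex) \<Rightarrow> real \<Rightarrow> real" where
  "max_mod f r = (SUP z\<in>sphere 0 r. cmod (f z))"

text \<open>A_R(f) (with \<nat> = {1,2,...}).\<close>
definition fast_escaping_level :: "(complex \<Rightarrow> complex) \<Rightarrow> real \<Rightarrow> complex set" where
  "fast_escaping_level f R = {z. \<forall>n\<ge>1. cmod ((f ^^ n) z) \<ge> (max_mod f ^^ n) R}"

definition spiders_web :: "complex set \<Rightarrow> bool" where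
  "spiders_web E \<longleftrightarrow> connected E \<and>
     (\<exists>G :: nat \<Rightarrow> complex set.
        (\<forall>n. bounded (G n) \<and> open (G n) \<and> connected (G n) \<and> simply_connected (G n)
             \<and> frontier (G n) \<subseteq> E \<and> G n \<subseteq> G (Suc n))
        \<and> (\<Union>n. G n) = UNIV)"

end

theory Submission
  imports Defs "HOL-Complex_Analysis.Complex_Analysis"
begin

text \<open>
  The heart of the matter is a weak form of the Milloux-Schmidt inequality. Suppose an entire
  function is bounded by \<open>exp B\<close> on the disc of radius \<open>23 s\<close> and by 1 at some point of every circle
  of radius between \<open>s\<close> and \<open>2 s\<close>; then it is bounded by \<open>exp (11/12 B)\<close> on the disc of radius \<open>s\<close>.
  Otherwise it would have few zeros nearby, and Harnack's inequality for the zero-free factor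
  together with a Chebyshev estimate for the polynomial of zeros would yield a circle on which it
  exceeds 1. Iterating, if \<open>log M(r) \<le> r powr \<epsilon>\<close>, then some circle of radius between
  \<open>r powr (1 - O(\<epsilon>))\<close> and \<open>r\<close> has minimum modulus close to \<open>M (r powr (1 - O(\<epsilon>)))\<close>. As
  \<open>\<Sum>\<epsilon>\<^sub>n\<close> converges, this and the convexity of \<open>log M\<close> in \<open>log r\<close> give radii \<open>\<rho>\<^sub>n \<ge> R\<^sub>n\<close>, for large
  \<open>n\<close>, with \<open>\<bar>f z\<bar> \<ge> \<rho>\<^sub>n\<^sub>+\<^sub>1\<close> whenever \<open>\<bar>z\<bar> = \<rho>\<^sub>n\<close>.

  No curve from 0 to the circle of radius \<open>\<rho>\<^sub>n\<close> can then avoid \<open>A\<^bsub>R\<^sub>n\<^esub>(f)\<close>, so the component of 0 in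
  the complement of this set is bounded; these components are the domains \<open>G\<^sub>n\<close>. The maximum
  principle, applied to the iterates of \<open>f\<close>, shows that they are simply connected and that
  \<open>A\<^sub>R(f)\<close> is connected.
\<close>

section \<open>Minimum modulus on a circle\<close>

lemma max_on_circle:
  fixes f :: "complex \<Rightarrow> complex"
  assumes "f holomorphic_on UNIV" "0 \<le> r"
  obtains w where "cmod w = r" "\<And>z. cmod z \<le> r \<Longrightarrow> cmod (f z) \<le> cmod (f w)"
proof -
  have "compact (sphere (0::complex) r)" "sphere (0::complex) r \<noteq> {}"
    using \<open>0 \<le> r\<close> by auto
  moreover have cont: "continuous_on A f" for A
    using assms(1) holomorphic_on_imp_continuous_on continuous_on_subset by blast
  ultimately obtain w where w: "w \<in> sphere 0 r" "\<And>z. z \<in> sphere 0 r \<Longrightarrow> cmod (f z) \<le> cmod (f w)"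
    using continuous_attains_sup[of "sphere (0::complex) r" "\<lambda>z. cmod (f z)"]
    by (metis continuous_on_norm)
  have "cmod (f z) \<le> cmod (f w)" if "cmod z \<le> r" for z
  proof (rule maximum_modulus_frontier[of f "cball 0 r"])
    show "f holomorphic_on interior (cball 0 r)"
      using assms(1) holomorphic_on_subset by blast
  qed (use that w cont in \<open>auto simp: frontier_cball\<close>)
  then show ?thesis
    using w that[of w] by auto
qed

text \<open>The Joukowski map sends the unit circle onto the interval, turning a monic polynomial with
  real zeros into a function whose value at the origin is known.\<close>
lemma exists_prod_dist_ge:
  fixes xs :: "real list"
  assumes "a \<le> b"
  obtains t where "a \<le> t" "t \<le> b" "((b - a) / 4) ^ length xs \<le> (\<Prod>x\<leftarrow>xs. \<bar>t - x\<bar>)"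
proof -
  \<comment> \<open>For \<open>cmod w = 1\<close> each factor equals \<open>w * (t - x)\<close> with
    \<open>t\<close> as defined below; at 0 it is \<open>(b - a) / 4\<close>.\<close>
  define F where "F xs w = (\<Prod>x\<leftarrow>xs. of_real ((b - a) / 4) * (w\<^sup>2 + 1) + of_real ((a + b) / 2 - x) * w)"
    for xs :: "real list" and w :: complex
  have hol: "F xs holomorphic_on UNIV"
    by (induction xs) (auto simp: F_def[abs_def] intro!: holomorphic_intros)
  obtain w where w: "cmod w = 1" "\<And>z. cmod z \<le> 1 \<Longrightarrow> cmod (F xs z) \<le> cmod (F xs w)"
    using max_on_circle[OF hol, of 1] by auto
  define t where "t = (a + b) / 2 + (b - a) / 2 * Re w"
  have "w * cnj w = 1"
    using w(1) by (simp add: complex_norm_square [symmetric])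
  then have w2: "w\<^sup>2 + 1 = w * of_real (2 * Re w)"
    by (simp add: power2_eq_square distrib_left complex_add_cnj[symmetric] del: complex_add_cnj of_real_mult)
  have "F xs 0 = of_real ((b - a) / 4) ^ length xs"
    by (induction xs) (auto simp: F_def)
  then have "cmod (F xs 0) = ((b - a) / 4) ^ length xs"
    using assms by (simp add: norm_power del: of_real_divide of_real_diff)
  moreover have "cmod (F xs w) = (\<Prod>x\<leftarrow>xs. \<bar>t - x\<bar>)"
  proof -
    have "of_real ((b - a) / 4) * (w\<^sup>2 + 1) + of_real ((a + b) / 2 - x) * w = w * of_real (t - x)" for x
      unfolding w2 t_def by (simp add: field_simps)
    then show ?thesis
      using w(1) unfolding F_def
      by (induction xs) (auto simp: norm_mult simp del: of_real_diff)
  qed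
  moreover have "\<bar>Re w\<bar> \<le> 1"
    using abs_Re_le_cmod[of w] w(1) by simp
  then have "(b - a) / 2 * Re w \<le> (b - a) / 2 * 1" "(b - a) / 2 * (-1) \<le> (b - a) / 2 * Re w"
    using assms by (intro mult_left_mono; auto)+
  then have "a \<le> t" "t \<le> b"
    unfolding t_def by (auto simp: field_simps)
  ultimately show ?thesis
    using w(2)[of 0] that[of t] by auto
qed

section \<open>Harnack's inequality on a disc\<close>

lemma Harnack_pos:
  assumes hol: "g holomorphic_on ball a \<rho>" and pos: "\<And>z. z \<in> ball a \<rho> \<Longrightarrow> 0 < Re (g z)"
    and z: "z \<in> ball a \<rho>"
  shows "(\<rho> - dist a z) * Re (g z) \<le> (\<rho> + dist a z) * Re (g a)"
proof -
  define r where "r = dist a z"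
  have r: "0 \<le> r" "r < \<rho>" using z by (auto simp: r_def)
  define \<omega> where "\<omega> \<zeta> = (g (a + of_real \<rho> * \<zeta>) - g a) / (g (a + of_real \<rho> * \<zeta>) + cnj (g a))" for \<zeta>
  have ball: "a + of_real \<rho> * \<zeta> \<in> ball a \<rho>" if "cmod \<zeta> < 1" for \<zeta>
    using that r by (simp add: dist_norm norm_mult)
  have a: "0 < Re (g a)" using pos[of a] r by simp
  have nz: "g (a + of_real \<rho> * \<zeta>) + cnj (g a) \<noteq> 0" if "cmod \<zeta> < 1" for \<zeta>
    using pos[OF ball[OF that]] a by (auto simp: complex_eq_iff)
  have "\<omega> holomorphic_on ball 0 1"
    unfolding \<omega>_def
    by (intro holomorphic_intros holomorphic_on_compose_gen[OF _ hol, unfolded o_def])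
       (use ball nz in auto)
  moreover have "cmod (\<omega> \<zeta>) < 1" if "cmod \<zeta> < 1" for \<zeta>
  proof -
    define w where "w = g (a + of_real \<rho> * \<zeta>)"
    have "0 < Re w * Re (g a)" using pos[OF ball[OF that]] a by (simp add: w_def)
    then have "(cmod (w - g a))\<^sup>2 < (cmod (w + cnj (g a)))\<^sup>2"
      unfolding cmod_power2 by (simp add: power2_eq_square algebra_simps)
    then have "cmod (w - g a) < cmod (w + cnj (g a))"
      by (rule power2_less_imp_less) simp
    then show ?thesis
      using nz[OF that] by (simp add: \<omega>_def norm_divide w_def)
  qed
  moreover have "\<omega> 0 = 0" by (simp add: \<omega>_def)
  moreover define \<zeta> where "\<zeta> = (z - a) / of_real \<rho>"
  have \<zeta>: "cmod \<zeta> < 1" "a + of_real \<rho> * \<zeta> = z" "cmod \<zeta> = r / \<rho>"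
    using r le_less_trans[OF r] by (auto simp: \<zeta>_def r_def dist_norm norm_divide norm_minus_commute)
  ultimately have "cmod (\<omega> \<zeta>) \<le> r / \<rho>"
    using Schwarz_Lemma(1)[of \<omega> \<zeta>] by auto
  then have "\<rho> * cmod (g z - g a) \<le> r * cmod (g z + cnj (g a))"
    using r nz[OF \<zeta>(1)] \<zeta> by (simp add: \<omega>_def norm_divide field_simps)
  then have "(\<rho> * cmod (g z - g a))\<^sup>2 \<le> (r * cmod (g z + cnj (g a)))\<^sup>2"
    using r by (intro power_mono) auto
  then have "\<rho>\<^sup>2 * (Re (g z) - Re (g a))\<^sup>2 + \<rho>\<^sup>2 * (Im (g z) - Im (g a))\<^sup>2
      \<le> r\<^sup>2 * (Re (g z) + Re (g a))\<^sup>2 + r\<^sup>2 * (Im (g z) - Im (g a))\<^sup>2"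
    by (simp add: power_mult_distrib cmod_power2 distrib_left)
  moreover have "r\<^sup>2 * (Im (g z) - Im (g a))\<^sup>2 \<le> \<rho>\<^sup>2 * (Im (g z) - Im (g a))\<^sup>2"
    using r by (intro mult_right_mono power_mono) auto
  ultimately have "(\<rho> * (Re (g z) - Re (g a)))\<^sup>2 \<le> (r * (Re (g z) + Re (g a)))\<^sup>2"
    by (simp add: power_mult_distrib)
  then have "\<rho> * (Re (g z) - Re (g a)) \<le> r * (Re (g z) + Re (g a))"
    by (rule power2_le_imp_le) (use r a pos[OF z] in auto)
  then show ?thesis
    by (simp add: r_def[symmetric] algebra_simps)
qed

lemma Harnack_upper:
  assumes hol: "g holomorphic_on ball a \<rho>" and pos: "\<And>z. z \<in> ball a \<rho> \<Longrightarrow> 0 \<le> Re (g z)"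
    and z: "z \<in> ball a \<rho>"
  shows "(\<rho> - dist a z) * Re (g z) \<le> (\<rho> + dist a z) * Re (g a)"
proof (rule field_le_epsilon)
  fix e :: real assume "0 < e"
  have *: "0 < \<rho> + dist a z" using z by (simp add: add_pos_nonneg le_less_trans[OF zero_le_dist])
  define d where "d = e / (\<rho> + dist a z)"
  have d: "d > 0" "d * (\<rho> + dist a z) = e" using * \<open>0 < e\<close> by (auto simp: d_def)
  have "(\<rho> - dist a z) * Re (g z + of_real d) \<le> (\<rho> + dist a z) * Re (g a + of_real d)"
  proof (rule Harnack_pos[OF _ _ z])
    show "(\<lambda>z. g z + of_real d) holomorphic_on ball a \<rho>" by (intro holomorphic_intros hol)
  qed (use pos d in \<open>auto intro: add_nonneg_pos\<close>)
  moreover have "0 \<le> (\<rho> - dist a z) * d" using z d by auto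
  ultimately show "(\<rho> - dist a z) * Re (g z) \<le> (\<rho> + dist a z) * Re (g a) + e"
    using d by (simp add: distrib_left mult.commute)
qed

section \<open>Splitting off the zeros in a disc\<close>

lemma norm_prod_list_diff_ge:
  fixes as :: "complex list"
  assumes "set as \<subseteq> cball 0 r" "r < cmod z"
  shows "(cmod z - r) ^ length as \<le> cmod (\<Prod>a\<leftarrow>as. z - a)"
  using assms
proof (induction as)
  case (Cons a as)
  have "cmod z - r \<le> cmod (z - a)"
    using Cons.prems norm_triangle_ineq2[of z a] by auto
  then have "(cmod z - r) * (cmod z - r) ^ length as \<le> cmod (z - a) * cmod (\<Prod>a\<leftarrow>as. z - a)"
    using Cons by (intro mult_mono) auto
  then show ?case by (simp add: norm_mult)
qed simp

lemma norm_prod_list_diff_le: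
  fixes as :: "complex list"
  assumes "set as \<subseteq> cball 0 r"
  shows "cmod (\<Prod>a\<leftarrow>as. z - a) \<le> (cmod z + r) ^ length as"
  using assms
proof (induction as)
  case (Cons a as)
  have "cmod (z - a) \<le> cmod z + r"
    using Cons.prems norm_triangle_ineq4[of z a] by auto
  then have "cmod (z - a) * cmod (\<Prod>a\<leftarrow>as. z - a) \<le> (cmod z + r) * (cmod z + r) ^ length as"
    using Cons by (intro mult_mono) (auto intro: order_trans[OF norm_ge_zero])
  then show ?case by (simp add: norm_mult)
qed simp

text \<open>By the maximum principle it suffices to bound \<open>h\<close> on the circle of radius
  \<open>R\<close>, where every factor \<open>z - a\<close> has modulus at least
  \<open>R - r\<close>.\<close>

lemma quotient_bound:
  fixes f h :: "complex \<Rightarrow> complex"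
  assumes h: "h holomorphic_on UNIV" and f: "\<And>z. f z = (\<Prod>a\<leftarrow>as. z - a) * h z"
    and as: "set as \<subseteq> cball 0 r" and R: "0 \<le> r" "r < R" and M: "\<And>z. cmod z = R \<Longrightarrow> cmod (f z) \<le> M"
    and z: "cmod z \<le> R"
  shows "cmod (h z) * (R - r) ^ length as \<le> M"
proof -
  obtain w where w: "cmod w = R" "\<And>z. cmod z \<le> R \<Longrightarrow> cmod (h z) \<le> cmod (h w)"
    using max_on_circle[OF h, of R] R by auto
  have "cmod (h z) * (R - r) ^ length as \<le> cmod (h w) * (cmod (\<Prod>a\<leftarrow>as. w - a))"
    using w z norm_prod_list_diff_ge[OF as, of w] R by (intro mult_mono) auto
  also have "\<dots> = cmod (f w)" by (simp add: f norm_mult)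
  also have "\<dots> \<le> M" using M w by auto
  finally show ?thesis .
qed

text \<open>Zeros are removed one at a time. Comparing \<open>z0\<close> with a large circle bounds
  how many can be removed, so a longest list exists, and its cofactor has no zero left in the
  disc.\<close>

lemma factor_out_zeros:
  fixes f :: "complex \<Rightarrow> complex"
  assumes f: "f holomorphic_on UNIV" and z0: "f z0 \<noteq> 0" and r: "0 \<le> r"
  obtains as h where "h holomorphic_on UNIV" "set as \<subseteq> cball 0 r"
    "\<And>z. f z = (\<Prod>a\<leftarrow>as. z - a) * h z" "\<And>z. z \<in> cball 0 r \<Longrightarrow> h z \<noteq> 0"
proof -
  define P where "P as h \<longleftrightarrow> h holomorphic_on UNIV \<and> set as \<subseteq> cball 0 r \<and> (\<forall>z. f z = (\<Prod>a\<leftarrow>as. z - a) * h z)"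
    for as h
  \<comment> \<open>Each zero is within \<open>q\<close> of \<open>z0\<close> but at least
    \<open>2 * q\<close> from the circle of radius \<open>R\<close>, so it accounts for a factor
    2.\<close>
  define q where "q = cmod z0 + r + 1"
  define R where "R = r + 2 * q"
  have q: "q > 0" "cmod z0 \<le> R" "r < R" using r by (auto simp: q_def R_def add_nonneg_pos)
  obtain w where w: "cmod w = R" "\<And>z. cmod z \<le> R \<Longrightarrow> cmod (f z) \<le> cmod (f w)"
    using max_on_circle[OF f, of R] q r by auto
  have bd: "2 ^ length as \<le> cmod (f w) / cmod (f z0)" if "P as h" for as h
  proof -
    let ?n = "length as"
    have 1: "cmod (h z0) * (2 * q) ^ ?n \<le> cmod (f w)"
      using quotient_bound[of h f as r R "cmod (f w)" z0] that q r w by (auto simp: P_def R_def)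
    have "cmod (\<Prod>a\<leftarrow>as. z0 - a) \<le> (cmod z0 + r) ^ ?n"
      using norm_prod_list_diff_le that by (auto simp: P_def)
    also have "\<dots> \<le> q ^ ?n" using r by (intro power_mono) (auto simp: q_def)
    finally have "cmod (f z0) \<le> q ^ ?n * cmod (h z0)"
      using that by (auto simp: P_def norm_mult intro: mult_right_mono)
    then have "2 ^ ?n * cmod (f z0) \<le> 2 ^ ?n * (q ^ ?n * cmod (h z0))"
      by (intro mult_left_mono) auto
    also have "\<dots> \<le> cmod (f w)" using 1 by (simp add: power_mult_distrib mult_ac)
    finally show ?thesis
      using z0 by (simp add: field_simps)
  qed
  define Q where "Q n \<longleftrightarrow> (\<exists>as h. P as h \<and> length as = n)" for n
  obtain m :: nat where m: "cmod (f w) / cmod (f z0) < 2 ^ m"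
    using real_arch_pow[of 2] by auto
  have QI: "Q (length as)" if "P as h" for as h using that by (auto simp: Q_def)
  have "P [] f" using f by (simp add: P_def)
  then have "Q 0" using QI by fastforce
  moreover have "n \<le> m" if "Q n" for n
  proof -
    obtain as h where "P as h" "length as = n" using \<open>Q n\<close> by (auto simp: Q_def)
    then have "(2::real) ^ n < 2 ^ m" using le_less_trans[OF bd m, of as h] by simp
    then show ?thesis by simp
  qed
  ultimately have Qmax: "Q (Greatest Q)" "\<And>n. Q n \<Longrightarrow> n \<le> Greatest Q"
    by (auto intro: GreatestI_nat Greatest_le_nat)
  then obtain as h where as: "P as h" "length as = Greatest Q" by (auto simp: Q_def)
  have "h b \<noteq> 0" if b: "b \<in> cball 0 r" for b
  proof
    assume hb: "h b = 0"
    define k where "k z = (if z = b then deriv h b else h z / (z - b))" for z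
    have "k holomorphic_on UNIV"
      by (rule pole_theorem_open_0[of h _ b]) (use as hb in \<open>auto simp: P_def k_def\<close>)
    moreover have "h z = (z - b) * k z" for z using hb by (auto simp: k_def)
    ultimately have "P (b # as) k"
      using as b by (auto simp: P_def)
    then have "Q (Suc (Greatest Q))" using QI as(2) by fastforce
    then show False using Qmax(2) by fastforce
  qed
  then show ?thesis using that as by (auto simp: P_def)
qed

section \<open>A weak Milloux-Schmidt inequality\<close>

text \<open>Suppose \<open>f z0\<close> is too large and let \<open>b\<close> be the logarithm of
  its modulus. Counting zeros gives \<open>n * ln 3 \<le> B - b\<close>; Harnack bounds the
  zero-free factor below by \<open>exp (B - n * ln 18 - 7 * (B - b))\<close> for
  \<open>cmod z \<le> 2\<close>; on a suitable circle the polynomial is at least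
  \<open>4 ^ -n\<close>. Smallness there yields \<open>B \<le> 12 * (B - b) < B\<close>.\<close>

lemma contraction_unit:
  fixes f :: "complex \<Rightarrow> complex"
  assumes f: "f holomorphic_on UNIV"
    and B: "\<And>z. cmod z = 23 \<Longrightarrow> cmod (f z) \<le> exp B"
    and small: "\<And>t. 1 \<le> t \<Longrightarrow> t \<le> 2 \<Longrightarrow> \<exists>z. cmod z = t \<and> cmod (f z) \<le> 1"
    and z0: "cmod z0 \<le> 1"
  shows "cmod (f z0) \<le> exp (11 / 12 * B)"
proof (rule ccontr)
  assume "\<not> ?thesis"
  then have contra: "exp (11 / 12 * B) < cmod (f z0)" by simp
  then have fz0: "f z0 \<noteq> 0" by auto
  define b where "b = ln (cmod (f z0))"
  have b2: "exp b = cmod (f z0)" using fz0 by (simp add: b_def)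
  have b1: "11 / 12 * B < b" using contra unfolding b2[symmetric] exp_less_cancel_iff .
  obtain as h where h: "h holomorphic_on UNIV" and as: "set as \<subseteq> cball 0 5"
    and fh: "\<And>z. f z = (\<Prod>a\<leftarrow>as. z - a) * h z" and nz: "\<And>z. z \<in> cball 0 5 \<Longrightarrow> h z \<noteq> 0"
    by (rule factor_out_zeros[OF f fz0, of 5]) (simp, blast)
  define n where "n = length as"
  obtain g where g: "g holomorphic_on ball 0 5" "\<And>z. z \<in> ball 0 5 \<Longrightarrow> h z = exp (g z)"
  proof (rule contractible_imp_holomorphic_log[of h "ball 0 5"])
    show "h holomorphic_on ball 0 5" using h holomorphic_on_subset by blast
  qed (use nz in \<open>auto intro: convex_imp_contractible\<close>)
  \<comment> \<open>Here 18 is \<open>23 - 5\<close>, the least distance from a zero to the outer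
    circle; below, 6 is \<open>1 + 5\<close>, the largest possible distance from \<open>z0\<close>
    to a zero.\<close>
  have ub: "Re (g z) + real n * ln 18 \<le> B" if "z \<in> ball 0 5" for z
  proof -
    have "cmod (h z) * (23 - 5) ^ length as \<le> exp B"
      using quotient_bound[OF h fh as, of 23 "exp B" z] B that by auto
    then have "exp (Re (g z)) * 18 ^ n \<le> exp B"
      using g(2)[OF that] by (simp add: n_def)
    then have "exp (Re (g z) + real n * ln 18) \<le> exp B"
      by (simp add: exp_add exp_of_nat_mult)
    then show ?thesis by simp
  qed
  have "cmod (f z0) \<le> 6 ^ n * cmod (h z0)"
  proof -
    have "cmod (\<Prod>a\<leftarrow>as. z0 - a) \<le> (cmod z0 + 5) ^ n"
      using norm_prod_list_diff_le[OF as] by (simp add: n_def)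
    also have "\<dots> \<le> 6 ^ n" using z0 by (intro power_mono) auto
    finally show ?thesis by (simp add: fh norm_mult mult_right_mono)
  qed
  then have "exp b \<le> exp (real n * ln 6 + Re (g z0))"
    using g(2)[of z0] z0 b2 by (simp add: exp_add exp_of_nat_mult)
  then have lb: "b \<le> real n * ln 6 + Re (g z0)" by simp
  define G where "G z = of_real (B - real n * ln 18) - g z" for z
  have ln18: "ln 18 = ln 6 + ln (3::real)" using ln_mult[of "6::real" 3] by simp
  have sub: "ball z0 4 \<subseteq> ball 0 5"
    using z0 by (auto simp: ball_subset_ball_iff)
  have G0: "Re (G z0) \<le> B - b - real n * ln 3" "0 \<le> Re (G z0)"
    using lb ub[of z0] z0 by (auto simp: G_def ln18 algebra_simps)
  have n3: "real n * ln 3 \<le> B - b" using G0 by linarith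
  have Gle: "Re (G z) \<le> 7 * (B - b)" if "cmod z \<le> 2" for z
  proof -
    \<comment> \<open>With distance at most 3 in a disc of radius 4, the Harnack constant is
      \<open>(4 + 3) / (4 - 3) = 7\<close>.\<close>
    have d: "dist z0 z \<le> 3" using z0 that norm_triangle_ineq4[of z0 z] by (simp add: dist_norm)
    have pos: "0 \<le> Re (G w)" if "w \<in> ball z0 4" for w
      using ub[of w] sub that by (auto simp: G_def)
    have "(4 - dist z0 z) * Re (G z) \<le> (4 + dist z0 z) * Re (G z0)"
    proof (rule Harnack_upper)
      show "G holomorphic_on ball z0 4" unfolding G_def
        by (intro holomorphic_intros holomorphic_on_subset[OF g(1) sub])
    qed (use d pos in auto)
    moreover have "1 * Re (G z) \<le> (4 - dist z0 z) * Re (G z)"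
      using d pos[of z] by (intro mult_right_mono) auto
    moreover have "(4 + dist z0 z) * Re (G z0) \<le> 7 * Re (G z0)"
      using d G0 by (intro mult_right_mono) auto
    moreover have "Re (G z0) \<le> B - b" using G0 by (simp add: order_trans)
    ultimately show ?thesis by simp
  qed
  \<comment> \<open>Only the moduli of the zeros matter, since \<open>cmod (z - a)\<close> is at
    least the distance from \<open>t\<close> to \<open>cmod a\<close>.\<close>
  obtain t where t: "1 \<le> t" "t \<le> 2" "((2 - 1) / 4) ^ length (map cmod as) \<le> (\<Prod>x\<leftarrow>map cmod as. \<bar>t - x\<bar>)"
    using exists_prod_dist_ge[of 1 2 "map cmod as"] by auto
  obtain z where z: "cmod z = t" "cmod (f z) \<le> 1" using small[OF t(1,2)] by auto
  have "(\<Prod>x\<leftarrow>map cmod as. \<bar>t - x\<bar>) \<le> cmod (\<Prod>a\<leftarrow>as. z - a)"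
    unfolding z(1)[symmetric]
  proof (induction as)
    case (Cons a as)
    then show ?case
      using norm_triangle_ineq3[of z a] by (auto simp: norm_mult intro!: mult_mono prod_list_nonneg)
  qed simp
  then have "(1 / 4) ^ n \<le> cmod (\<Prod>a\<leftarrow>as. z - a)" using t(3) by (simp add: n_def)
  then have "(1 / 4) ^ n * cmod (h z) \<le> 1"
    using z(2) by (auto simp: fh norm_mult intro: order_trans[OF mult_right_mono])
  then have "exp (Re (g z)) \<le> exp (real n * ln 4)"
    using g(2)[of z] z(1) t by (simp add: exp_of_nat_mult field_simps)
  then have "B - real n * ln 18 - 7 * (B - b) \<le> real n * ln 4"
    using Gle[of z] z(1) t by (simp add: G_def)
  \<comment> \<open>The zeros thus cost at most \<open>5 * (B - b)\<close>; with Harnack's 7 this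
    makes the 12 behind \<open>11 / 12\<close>.\<close>
  moreover have "ln 18 + ln 4 \<le> 5 * ln (3::real)"
  proof -
    have "ln 18 + ln 4 = ln (72::real)" using ln_mult[of "18::real" 4] by simp
    also have "\<dots> \<le> ln (3 ^ 5)" by (subst ln_le_cancel_iff) auto
    also have "\<dots> = 5 * ln (3::real)" by (simp only: ln_realpow)
    finally show ?thesis .
  qed
  then have "real n * (ln 18 + ln 4) \<le> real n * (5 * ln 3)" by (intro mult_left_mono) auto
  ultimately show False using n3 b1 by (simp add: algebra_simps)
qed

lemma contraction:
  fixes f :: "complex \<Rightarrow> complex"
  assumes f: "f holomorphic_on UNIV" and s: "0 < s"
    and B: "\<And>z. cmod z = 23 * s \<Longrightarrow> cmod (f z) \<le> exp B"
    and small: "\<And>t. s \<le> t \<Longrightarrow> t \<le> 2 * s \<Longrightarrow> \<exists>z. cmod z = t \<and> cmod (f z) \<le> 1"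
    and z0: "cmod z0 \<le> s"
  shows "cmod (f z0) \<le> exp (11 / 12 * B)"
proof -
  have "cmod ((\<lambda>z. f (of_real s * z)) (z0 / of_real s)) \<le> exp (11 / 12 * B)"
  proof (rule contraction_unit[where f = "\<lambda>z. f (of_real s * z)"])
    show "(\<lambda>z. f (of_real s * z)) holomorphic_on UNIV"
      by (intro holomorphic_on_compose_gen[OF _ f, unfolded o_def] holomorphic_intros) auto
    fix t :: real assume "1 \<le> t" "t \<le> 2"
    then obtain z where "cmod z = t * s" "cmod (f z) \<le> 1"
      using small[of "t * s"] s by auto
    then show "\<exists>z. cmod z = t \<and> cmod (f (of_real s * z)) \<le> 1"
      using s by (intro exI[of _ "z / of_real s"]) (auto simp: norm_divide)
  qed (use B s z0 in \<open>auto simp: norm_mult norm_divide\<close>)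
  then show ?thesis using s by simp
qed

text \<open>Each division of the radius by 23 multiplies the exponent by \<open>11 / 12\<close>. The
  induction treats the outermost factor 23 first.\<close>

lemma iterated_contraction:
  fixes f :: "complex \<Rightarrow> complex"
  assumes f: "f holomorphic_on UNIV" and s: "0 < s"
    and B: "\<And>z. cmod z \<le> 23 ^ k * s \<Longrightarrow> cmod (f z) \<le> exp B"
    and small: "\<And>t. s \<le> t \<Longrightarrow> t \<le> 23 ^ k * s \<Longrightarrow> \<exists>z. cmod z = t \<and> cmod (f z) \<le> 1"
    and z: "cmod z \<le> s"
  shows "cmod (f z) \<le> exp ((11 / 12) ^ k * B)"
  using B small
proof (induction k arbitrary: B)
  case 0
  then show ?case using z by simp
next
  case (Suc k)
  let ?s = "23 ^ k * s"
  have s1: "s \<le> ?s" "0 < ?s" using s by auto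
  have "cmod (f z) \<le> exp ((11 / 12) ^ k * (11 / 12 * B))"
  proof (rule Suc.IH)
    fix z assume "cmod z \<le> ?s"
    then show "cmod (f z) \<le> exp (11 / 12 * B)"
    proof (intro contraction[OF f s1(2)])
      fix t assume "?s \<le> t" "t \<le> 2 * ?s"
      then show "\<exists>z. cmod z = t \<and> cmod (f z) \<le> 1" using s1 by (intro Suc.prems) auto
    qed (use Suc.prems(1) in auto)
  next
    fix t assume "s \<le> t" "t \<le> ?s"
    then show "\<exists>z. cmod z = t \<and> cmod (f z) \<le> 1" using s1 by (intro Suc.prems) auto
  qed
  then show ?case by (simp add: mult_ac)
qed

text \<open>Otherwise every circle in the range has a point where \<open>f\<close> is below
  \<open>exp L\<close>, and contracting \<open>f / exp L\<close> gives
  \<open>cmod (f z0) \<le> exp (L + 1)\<close>.\<close>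

lemma exists_circle_large:
  fixes f :: "complex \<Rightarrow> complex"
  assumes f: "f holomorphic_on UNIV" and s: "0 < s"
    and B: "\<And>z. cmod z \<le> 23 ^ k * s \<Longrightarrow> cmod (f z) \<le> exp B"
    and k: "(11 / 12) ^ k * (B - L) \<le> 1"
    and z0: "cmod z0 \<le> s" "exp (L + 1) < cmod (f z0)"
  obtains t where "s \<le> t" "t \<le> 23 ^ k * s" "\<And>z. cmod z = t \<Longrightarrow> exp L \<le> cmod (f z)"
proof (rule ccontr)
  assume "\<not> thesis"
  then have small: "\<exists>z. cmod z = t \<and> cmod (f z) < exp L" if "s \<le> t" "t \<le> 23 ^ k * s" for t
    using that by (meson not_le \<open>\<And>t. \<lbrakk>s \<le> t; t \<le> 23 ^ k * s; \<And>z. cmod z = t \<Longrightarrow> exp L \<le> cmod (f z)\<rbrakk> \<Longrightarrow> thesis\<close>)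
  have n: "cmod (of_real (exp (- L)) * f z) = cmod (f z) / exp L" for z
    by (simp only: norm_mult norm_of_real abs_exp_cancel, simp only: exp_minus divide_inverse mult.commute)
  have "cmod ((\<lambda>z. of_real (exp (- L)) * f z) z0) \<le> exp ((11 / 12) ^ k * (B - L))"
  proof (rule iterated_contraction[where f = "\<lambda>z. of_real (exp (- L)) * f z", OF _ s])
    show "(\<lambda>z. of_real (exp (- L)) * f z) holomorphic_on UNIV" by (intro holomorphic_intros f)
    show "cmod (of_real (exp (- L)) * f z) \<le> exp (B - L)" if "cmod z \<le> 23 ^ k * s" for z
      using B[OF that] unfolding n by (simp add: exp_diff divide_right_mono)
    fix t assume "s \<le> t" "t \<le> 23 ^ k * s"
    from small[OF this] show "\<exists>z. cmod z = t \<and> cmod (of_real (exp (- L)) * f z) \<le> 1"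
      unfolding n by auto
  qed (use z0 in auto)
  also have "\<dots> \<le> exp 1" using k by simp
  finally show False using z0(2) by (simp only: n) (simp add: exp_add field_simps)
qed

section \<open>Growth of the maximum modulus\<close>

lemma max_mod_attained_disc:
  assumes f: "f holomorphic_on UNIV" and r: "0 \<le> r"
  obtains w where "cmod w = r" "cmod (f w) = max_mod f r" "\<And>z. cmod z \<le> r \<Longrightarrow> cmod (f z) \<le> max_mod f r"
proof -
  obtain w where w: "cmod w = r" "\<And>z. cmod z \<le> r \<Longrightarrow> cmod (f z) \<le> cmod (f w)"
    using max_on_circle[OF f r] by auto
  have "max_mod f r = cmod (f w)"
    unfolding max_mod_def by (rule cSup_eq_maximum) (use w in auto)
  then show ?thesis using that[of w] w by auto
qed

lemma max_mod_attained:
  assumes "f holomorphic_on UNIV" "0 \<le> r"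
  obtains w where "cmod w = r" "cmod (f w) = max_mod f r"
  using max_mod_attained_disc[OF assms] by blast

lemma norm_le_max_mod:
  assumes "f holomorphic_on UNIV" "cmod z \<le> r"
  shows "cmod (f z) \<le> max_mod f r"
  using max_mod_attained_disc[of f r] assms norm_ge_zero order_trans by metis

lemma max_mod_mono:
  assumes f: "f holomorphic_on UNIV" and "0 \<le> r" "r \<le> s"
  shows "max_mod f r \<le> max_mod f s"
proof -
  obtain w where "cmod w = r" "cmod (f w) = max_mod f r"
    using max_mod_attained[OF f \<open>0 \<le> r\<close>] by auto
  then show ?thesis using norm_le_max_mod[OF f, of w s] \<open>r \<le> s\<close> by simp
qed

lemma norm_less_max_mod:
  assumes f: "f holomorphic_on UNIV" and nc: "\<not> f constant_on UNIV" and z: "cmod z < r"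
  shows "cmod (f z) < max_mod f r"
proof (rule ccontr)
  assume "\<not> ?thesis"
  then have "cmod (f v) \<le> cmod (f z)" if "v \<in> ball 0 r" for v
    using norm_le_max_mod[OF f, of v r] that by simp
  then have "f constant_on UNIV"
    using maximum_modulus_principle[OF f open_UNIV connected_UNIV, of "ball 0 r" z] z by simp
  then show False using nc by simp
qed

lemma max_mod_pos:
  assumes "f holomorphic_on UNIV" "\<not> f constant_on UNIV" "0 < r"
  shows "0 < max_mod f r"
  using norm_less_max_mod[OF assms(1,2), of 0 r] assms(3) by (auto intro: le_less_trans[OF norm_ge_zero])

text \<open>Hadamard's three circles theorem: in the coordinate \<open>w = log z\<close>, the function
  \<open>f (exp w) exp (- \<alpha> w)\<close> has periodic modulus, so its maximum over a vertical strip is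
  attained and the maximum principle applies.\<close>
lemma three_circles:
  assumes f: "f holomorphic_on UNIV" and nc: "\<not> f constant_on UNIV"
    and x: "x0 < x1" "x0 \<le> x" "x \<le> x1"
  shows "(x1 - x0) * ln (max_mod f (exp x))
    \<le> (x1 - x) * ln (max_mod f (exp x0)) + (x - x0) * ln (max_mod f (exp x1))"
proof -
  define \<phi> where "\<phi> x = ln (max_mod f (exp x))" for x
  have M: "max_mod f (exp x) = exp (\<phi> x)" for x
    using max_mod_pos[OF f nc, of "exp x"] by (simp add: \<phi>_def)
  \<comment> \<open>The slope of the chord of \<open>\<phi>\<close>, chosen so that \<open>F\<close>
    has the same bound \<open>K\<close> on both sides of the strip.\<close>
  define \<alpha> where "\<alpha> = (\<phi> x1 - \<phi> x0) / (x1 - x0)"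
  define F where "F w = f (exp w) * exp (- of_real \<alpha> * w)" for w
  define K where "K = exp (\<phi> x0 - \<alpha> * x0)"
  have K1: "K = exp (\<phi> x1 - \<alpha> * x1)"
    using x(1) unfolding K_def \<alpha>_def by (simp add: field_simps)
  have hol: "F holomorphic_on A" for A unfolding F_def
    by (intro holomorphic_intros holomorphic_on_compose_gen[OF _ f, unfolded o_def]) auto
  then have cont: "continuous_on A F" for A by (simp add: holomorphic_on_imp_continuous_on)
  have normF: "cmod (F w) = cmod (f (exp w)) * exp (- \<alpha> * Re w)" for w
    by (simp add: F_def norm_mult)
  have K: "cmod (F w) \<le> K" if "Re w = x0 \<or> Re w = x1" for w
  proof -
    have "cmod (F w) \<le> exp (\<phi> (Re w)) * exp (- \<alpha> * Re w)"
      using norm_le_max_mod[OF f, of "exp w" "exp (Re w)"] by (simp add: normF M)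
    also have "\<dots> = exp (\<phi> (Re w) - \<alpha> * Re w)" by (simp flip: exp_add)
    also have "\<dots> = K" using that K1 by (auto simp: K_def)
    finally show ?thesis .
  qed
  let ?S = "{w. x0 < Re w \<and> Re w < x1}"
  have le: "cmod (F w) \<le> K" if w: "x0 \<le> Re w" "Re w \<le> x1" for w
  proof (rule ccontr)
    assume contra: "\<not> ?thesis"
    define Q where "Q = cbox (Complex x0 (- pi)) (Complex x1 pi)"
    \<comment> \<open>\<open>Ln (exp w)\<close> differs from \<open>w\<close> by a period, which
      leaves the modulus of \<open>F\<close> unchanged.\<close>
    have red: "\<exists>w'\<in>Q. cmod (F w') = cmod (F w)" if "x0 \<le> Re w" "Re w \<le> x1" for w
      using that mpi_less_Im_Ln[of "exp w"] Im_Ln_le_pi[of "exp w"]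
      by (intro bexI[of _ "Ln (exp w)"]) (auto simp: normF Q_def in_cbox_complex_iff)
    have "compact Q" "Q \<noteq> {}" using red[OF w] by (auto simp: Q_def)
    then obtain w0 where w0: "w0 \<in> Q" "\<And>v. v \<in> Q \<Longrightarrow> cmod (F v) \<le> cmod (F w0)"
      using continuous_attains_sup[of Q "\<lambda>w. cmod (F w)"] cont by (metis continuous_on_norm)
    have max: "cmod (F v) \<le> cmod (F w0)" if "x0 \<le> Re v" "Re v \<le> x1" for v
      using red[OF that] w0(2) by metis
    have big: "K < cmod (F w0)" using max[OF w] contra by simp
    then have "Re w0 \<noteq> x0" "Re w0 \<noteq> x1" using K[of w0] by auto
    then have w0S: "w0 \<in> ?S" using w0(1) by (auto simp: Q_def in_cbox_complex_iff)
    have S: "?S = {w. x0 < Re w} \<inter> {w. Re w < x1}" by auto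
    have opS: "open ?S"
      by (simp add: S open_Int open_halfspace_Re_gt open_halfspace_Re_lt)
    moreover have "convex ?S"
      unfolding S by (intro convex_Int convex_halfspace_Re_gt convex_halfspace_Re_lt)
    ultimately have "F constant_on ?S"
      using maximum_modulus_principle[OF hol, of ?S ?S w0] w0S max by (auto intro: convex_connected)
    then have const: "F v = F w0" if "v \<in> ?S" for v
      using that w0S by (auto simp: constant_on_def)
    \<comment> \<open>By continuity the constant interior value persists on the boundary line, where
      it exceeds \<open>K\<close>.\<close>
    have "F (of_real x0) = F w0"
    proof (rule tendsto_unique)
      have "((\<lambda>t. of_real t :: complex) \<longlongrightarrow> of_real x0) (at_right x0)"
        by (intro tendsto_intros)
      moreover have "isCont F (of_real x0)"
        using cont[of UNIV] by (simp add: continuous_on_eq_continuous_at)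
      ultimately show "((\<lambda>t. F (of_real t)) \<longlongrightarrow> F (of_real x0)) (at_right x0)"
        by (rule isCont_tendsto_compose[rotated])
      have "\<forall>\<^sub>F t in at_right x0. t \<in> {x0<..<x1}"
        using x(1) by (rule eventually_at_right_real)
      then show "((\<lambda>t. F (of_real t)) \<longlongrightarrow> F w0) (at_right x0)"
        by (intro tendsto_eventually) (auto elim!: eventually_mono intro!: const)
    qed simp
    then show False using big K[of "of_real x0"] by simp
  qed
  obtain z where z: "cmod z = exp x" "cmod (f z) = exp (\<phi> x)"
    using max_mod_attained[OF f, of "exp x"] M by auto
  then have nz: "z \<noteq> 0" by auto
  then have Re: "Re (Ln z) = x" using z by simp
  have "exp (\<phi> x) * exp (- \<alpha> * x) \<le> K"
    using le[of "Ln z"] x Re nz z by (simp add: normF)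
  then have "exp (\<phi> x - \<alpha> * x) \<le> K" by (simp flip: exp_add)
  then have "\<phi> x \<le> \<phi> x0 + \<alpha> * (x - x0)"
    by (simp add: K_def algebra_simps)
  then have "(x1 - x0) * \<phi> x \<le> (x1 - x0) * (\<phi> x0 + \<alpha> * (x - x0))"
    using x(1) by (intro mult_left_mono) auto
  also have "\<dots> = (x1 - x0) * \<phi> x0 + (\<phi> x1 - \<phi> x0) * (x - x0)"
    using x(1) by (simp add: \<alpha>_def distrib_left)
  finally show ?thesis by (simp add: \<phi>_def algebra_simps)
qed

text \<open>Three circles with radii 1, \<open>exp x\<close> and \<open>exp (c * x)\<close>: raising
  the radius to the power \<open>c\<close> raises the maximum modulus to nearly that power.\<close>

lemma ln_max_mod_scale:
  assumes f: "f holomorphic_on UNIV" and nc: "\<not> f constant_on UNIV" and c: "1 \<le> c" and x: "0 < x"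
  shows "c * ln (max_mod f (exp x)) \<le> ln (max_mod f (exp (c * x))) + (c - 1) * ln (max_mod f 1)"
proof -
  have "x * (c * ln (max_mod f (exp x))) \<le> x * (ln (max_mod f (exp (c * x))) + (c - 1) * ln (max_mod f 1))"
    using three_circles[OF f nc, of 0 "c * x" x] c x by (simp add: algebra_simps)
  then show ?thesis using x by simp
qed

section \<open>Transcendental growth and divergence of the iterated maximum modulus\<close>

lemma transcendental_not_constant:
  assumes "transcendental_entire f"
  shows "\<not> f constant_on UNIV"
proof
  assume "f constant_on UNIV"
  then obtain c where "\<And>z. f z = c" by (auto simp: constant_on_def)
  then have "\<forall>z. f z = poly [:c:] z" by simp
  then show False using assms unfolding transcendental_entire_def by blast
qed

text \<open>As \<open>f\<close> is no polynomial, some Taylor coefficient of index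
  \<open>k > m\<close> is nonzero, and Cauchy's inequality bounds the maximum modulus below by
  \<open>d * r ^ k\<close>. The extra power of \<open>r\<close> absorbs \<open>d\<close>.\<close>

lemma transcendental_growth:
  assumes "transcendental_entire f"
  shows "\<forall>\<^sub>F r in at_top. r ^ m \<le> max_mod f r"
proof -
  have f: "f holomorphic_on UNIV" using assms by (simp add: transcendental_entire_def)
  have "\<exists>k>m. (deriv ^^ k) f 0 \<noteq> 0"
  proof (rule ccontr)
    assume *: "\<not> ?thesis"
    have "f z = poly (\<Sum>k\<le>m. monom ((deriv ^^ k) f 0 / fact k) k) z" for z
    proof -
      have "(\<lambda>n. (deriv ^^ n) f 0 / fact n * (z - 0) ^ n) sums f z"
        by (rule holomorphic_power_series[of f 0 "cmod z + 1"])
           (use f holomorphic_on_subset in auto)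
      moreover have "(\<lambda>n. (deriv ^^ n) f 0 / fact n * (z - 0) ^ n)
          sums (\<Sum>n\<le>m. (deriv ^^ n) f 0 / fact n * (z - 0) ^ n)"
        by (rule sums_finite) (use * in auto)
      ultimately have "f z = (\<Sum>n\<le>m. (deriv ^^ n) f 0 / fact n * (z - 0) ^ n)"
        by (rule sums_unique2)
      then show ?thesis by (simp add: poly_sum poly_monom)
    qed
    then show False using assms unfolding transcendental_entire_def by blast
  qed
  then obtain k where k: "m < k" "(deriv ^^ k) f 0 \<noteq> 0" by auto
  define d where "d = cmod ((deriv ^^ k) f 0) / fact k"
  have d: "d > 0" using k by (simp add: d_def)
  have "r ^ m \<le> max_mod f r" if "max 1 (1 / d) \<le> r" for r
  proof -
    have r: "1 \<le> r" "1 \<le> d * r" using that d by (auto simp: field_simps)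
    have "cmod ((deriv ^^ k) f 0) \<le> fact k * max_mod f r / r ^ k"
    proof (rule Cauchy_inequality)
      show "f holomorphic_on ball 0 r" using f holomorphic_on_subset by blast
      show "continuous_on (cball 0 r) f"
        using f holomorphic_on_imp_continuous_on continuous_on_subset by blast
    qed (use r norm_le_max_mod[OF f] in auto)
    then have "d * r ^ k \<le> max_mod f r" using r by (simp add: d_def field_simps)
    moreover have "r ^ m \<le> (d * r) * r ^ (k - 1)"
      using r k power_increasing[of m "k - 1" r] mult_mono[of 1 "d * r" "r ^ m" "r ^ (k - 1)"] by auto
    moreover have "(d * r) * r ^ (k - 1) = d * r ^ k"
      using k by (cases k) auto
    ultimately show ?thesis by linarith
  qed
  then show ?thesis unfolding eventually_at_top_linorder by blast
qed

context
  fixes f :: "complex \<Rightarrow> complex" and R :: real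
  assumes f: "f holomorphic_on UNIV" and R: "0 < R" and M: "\<forall>r\<ge>R. max_mod f r > r"
begin

lemma iterate_ge: "R \<le> (max_mod f ^^ n) R"
  by (induction n) (use M in fastforce)+

lemma incseq_iterate: "incseq (\<lambda>n. (max_mod f ^^ n) R)"
  by (rule incseq_SucI) (use iterate_ge M in \<open>simp add: less_imp_le\<close>)

text \<open>A bounded increasing orbit would have a limit \<open>l\<close> at which the maximum
  modulus is at most \<open>l\<close>.\<close>

lemma iterate_at_top: "filterlim (\<lambda>n. (max_mod f ^^ n) R) at_top sequentially"
proof -
  let ?R = "\<lambda>n. (max_mod f ^^ n) R"
  have "\<exists>n. C \<le> ?R n" for C
  proof (rule ccontr)
    assume "\<not> ?thesis"
    then have "\<forall>n. ?R n \<le> C" by (auto simp: not_le less_imp_le)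
    then obtain l where l: "?R \<longlonglongrightarrow> l" "\<forall>n. ?R n \<le> l"
      using incseq_convergent[OF incseq_iterate] by blast
    have "R \<le> l" using l(2) iterate_ge order_trans by blast
    then have l0: "0 < l" "l < max_mod f l" using M R by auto
    obtain w where w: "cmod w = l" "cmod (f w) = max_mod f l"
      using max_mod_attained[OF f, of l] l0 by auto
    \<comment> \<open>Continuity of \<open>f\<close> along the ray through a maximum point
      \<open>w\<close> stands in for continuity of \<open>max_mod f\<close>.\<close>
    have "(\<lambda>n. w * of_real (?R n / l)) \<longlonglongrightarrow> w * of_real (l / l)"
      using l0 by (intro tendsto_intros l(1)) auto
    moreover have "isCont f (w * of_real (l / l))"
      using holomorphic_on_imp_continuous_on[OF f] by (simp add: continuous_on_eq_continuous_at)
    ultimately have "(\<lambda>n. f (w * of_real (?R n / l))) \<longlonglongrightarrow> f (w * of_real (l / l))"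
      by (rule isCont_tendsto_compose[rotated])
    note tendsto_norm[OF this]
    moreover have "cmod (f (w * of_real (?R n / l))) \<le> l" for n
    proof -
      have "0 < ?R n" using iterate_ge[of n] R by linarith
      then have "cmod (f (w * of_real (?R n / l))) \<le> ?R (Suc n)"
        using norm_le_max_mod[OF f, of "w * of_real (?R n / l)" "?R n"] w l0
        by (simp add: norm_mult norm_divide)
      then show ?thesis using l(2) order_trans by blast
    qed
    ultimately have "cmod (f (w * of_real (l / l))) \<le> l"
      by (intro LIMSEQ_le_const2) auto
    then show False using w l0 by simp
  qed
  then show ?thesis
    unfolding filterlim_at_top eventually_sequentially
    using incseq_iterate by (meson incseqD order_trans)
qed

end

section \<open>Circles mapped outside circles\<close>

text \<open>All radii are given by their logarithms. The growth bound limits the number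
  \<open>k\<close> of contractions needed, and these lower the logarithmic radius by
  \<open>k * ln 23\<close>.\<close>

lemma circle_step:
  assumes f: "f holomorphic_on UNIV" and nc: "\<not> f constant_on UNIV"
    and a: "0 < a" "0 < y" and growth: "ln (max_mod f (exp y)) \<le> exp (a * y)"
    and \<sigma>: "\<sigma> \<le> y - (a * y / ln (12 / 11) + 1) * ln 23" and big: "2 \<le> ln (max_mod f (exp \<sigma>))"
  obtains t where "exp \<sigma> \<le> t" "t \<le> exp y"
    "\<And>z. cmod z = t \<Longrightarrow> exp (ln (max_mod f (exp \<sigma>)) - 2) \<le> cmod (f z)"
proof -
  define l where "l = ln (12 / 11 :: real)"
  have l: "l > 0" by (simp add: l_def)
  \<comment> \<open>The least \<open>k\<close> with
    \<open>(11 / 12) ^ k * exp (a * y) \<le> 1\<close>.\<close>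
  define k where "k = nat \<lceil>a * y / l\<rceil>"
  have k: "a * y / l \<le> real k" "real k \<le> a * y / l + 1"
    using a l by (auto simp: k_def)
  define s where "s = exp y / 23 ^ k"
  have s: "s = exp (y - real k * ln 23)" "23 ^ k * s = exp y"
    by (simp_all add: s_def exp_diff exp_of_nat_mult)
  have "real k * ln 23 \<le> (a * y / l + 1) * ln 23" using k by (intro mult_right_mono) auto
  then have "\<sigma> \<le> y - real k * ln 23" using \<sigma> unfolding l_def by linarith
  then have "exp \<sigma> \<le> s" by (simp add: s(1))
  define \<phi> where "\<phi> x = ln (max_mod f (exp x))" for x
  have M: "max_mod f (exp x) = exp (\<phi> x)" for x
    using max_mod_pos[OF f nc, of "exp x"] by (simp add: \<phi>_def)
  obtain z0 where z0: "cmod z0 = exp \<sigma>" "cmod (f z0) = exp (\<phi> \<sigma>)"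
    using max_mod_attained[OF f, of "exp \<sigma>"] M by auto
  have ck: "(11 / 12) ^ k = exp (- (real k * l))"
    by (simp add: l_def exp_minus exp_of_nat_mult power_divide)
  have "(11 / 12) ^ k * (\<phi> y - (\<phi> \<sigma> - 2)) \<le> (11 / 12) ^ k * exp (a * y)"
    using growth big by (intro mult_left_mono) (auto simp: \<phi>_def)
  also have "\<dots> \<le> 1"
    unfolding ck exp_add[symmetric] using k(1) l by (simp add: field_simps)
  finally have small: "(11 / 12) ^ k * (\<phi> y - (\<phi> \<sigma> - 2)) \<le> 1" .
  \<comment> \<open>Losing 2 in the exponent leaves the strict margin
    \<open>exp (L + 1) < cmod (f z0)\<close> for \<open>L = \<phi> \<sigma> - 2\<close>.\<close>
  obtain t where "s \<le> t" "t \<le> 23 ^ k * s" "\<And>z. cmod z = t \<Longrightarrow> exp (\<phi> \<sigma> - 2) \<le> cmod (f z)"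
  proof (rule exists_circle_large[OF f _ _ small])
    show "0 < s" by (simp add: s)
    show "cmod z0 \<le> s" using z0 \<open>exp \<sigma> \<le> s\<close> by simp
    show "cmod (f z) \<le> exp (\<phi> y)" if "cmod z \<le> 23 ^ k * s" for z
      using norm_le_max_mod[OF f that] by (simp only: s(2) M)
  qed (use z0 in auto)
  then show thesis
    using that[of t] \<open>exp \<sigma> \<le> s\<close> s(2) by (auto simp: \<phi>_def)
qed

text \<open>The radii are \<open>\<rho>\<^sub>n \<in> [R\<^sub>n, R\<^sub>n powr c\<^sub>n]\<close>, where \<open>c\<^sub>n\<close> decreases to 1 by an amount comparable to
  \<open>\<epsilon>\<^sub>n\<close> at each step; convexity transports the exponent from one level to the next.\<close>
lemma exists_radii:
  assumes tr: "transcendental_entire f" and R: "0 < R" and gt: "\<forall>r\<ge>R. max_mod f r > r"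
    and sum: "summable (\<lambda>n. SUP r\<in>{(max_mod f ^^ n) R .. (max_mod f ^^ Suc n) R}. ln (ln (max_mod f r)) / ln r)"
  obtains N :: nat and \<rho> :: "nat \<Rightarrow> real" where
    "\<And>n. N \<le> n \<Longrightarrow> (max_mod f ^^ n) R \<le> \<rho> n"
    "\<And>n z. N \<le> n \<Longrightarrow> cmod z = \<rho> n \<Longrightarrow> \<rho> (Suc n) \<le> cmod (f z)"
proof -
  have f: "f holomorphic_on UNIV" using tr by (simp add: transcendental_entire_def)
  note nc = transcendental_not_constant[OF tr]
  define \<phi> where "\<phi> x = ln (max_mod f (exp x))" for x
  have M: "max_mod f (exp x) = exp (\<phi> x)" for x
    using max_mod_pos[OF f nc, of "exp x"] by (simp add: \<phi>_def)
  have \<phi>_mono: "\<phi> x \<le> \<phi> y" if "x \<le> y" for x y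
    using max_mod_mono[OF f, of "exp x" "exp y"] that by (simp add: M)
  let ?R = "\<lambda>n. (max_mod f ^^ n) R"
  define x where "x n = ln (?R n)" for n
  have Rx: "?R n = exp (x n)" for n
    using iterate_ge[OF f R gt, of n] R by (simp add: x_def)
  have xS: "x (Suc n) = \<phi> (x n)" for n
    by (simp add: x_def \<phi>_def Rx[unfolded x_def, symmetric] flip: Rx)
  have x_mono: "x n \<le> x m" if "n \<le> m" for n m
    using incseqD[OF incseq_iterate[OF f R gt] that] by (simp add: Rx)
  define a where "a n = (SUP r\<in>{?R n .. ?R (Suc n)}. ln (ln (max_mod f r)) / ln r)" for n

  obtain r0 where r0: "\<And>r. r0 \<le> r \<Longrightarrow> r ^ 2 \<le> max_mod f r"
    using transcendental_growth[OF tr, of 2] unfolding eventually_at_top_linorder by blast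
  have "\<forall>\<^sub>F n in sequentially. max r0 (exp 3) \<le> ?R n"
    using iterate_at_top[OF f R gt] unfolding filterlim_at_top by blast
  then obtain n0 where n0: "\<And>n. n0 \<le> n \<Longrightarrow> max r0 (exp 3) \<le> ?R n"
    unfolding eventually_sequentially by blast
  have x3: "3 \<le> x n" and x2: "2 * x n \<le> x (Suc n)" if "n0 \<le> n" for n
  proof -
    have "exp 3 \<le> exp (x n)" "r0 \<le> exp (x n)" using n0[OF that] by (auto simp: Rx)
    moreover from this(2) have "exp (x n) ^ 2 \<le> exp (\<phi> (x n))" using r0 by (simp flip: M)
    then have "exp (2 * x n) \<le> exp (\<phi> (x n))" by (simp add: exp_double)
    ultimately show "3 \<le> x n" "2 * x n \<le> x (Suc n)" by (simp_all add: xS)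
  qed
  have a_ge: "ln (\<phi> y) / y \<le> a n" if n: "n0 \<le> n" and y: "x n \<le> y" "y \<le> x (Suc n)" for n y
  proof -
    have "ln (ln (max_mod f (exp y))) / ln (exp y) \<le> a n"
      unfolding a_def
    proof (rule cSUP_upper)
      show "exp y \<in> {?R n..?R (Suc n)}" using y unfolding Rx by simp
      \<comment> \<open>A real \<open>SUP\<close> is known to dominate its terms only once the set
        is bounded above; as \<open>v \<ge> 1\<close> and \<open>\<phi> v \<ge> 3\<close>, the
        numerator bounds the quotient.\<close>
      have "ln (ln (max_mod f r)) / ln r \<le> ln (x (Suc (Suc n)))" if "r \<in> {?R n..?R (Suc n)}" for r
      proof -
        define v where "v = ln r"
        have "0 < r" using that order.trans[OF less_imp_le[of 0]] unfolding Rx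
          by (auto intro: less_le_trans[OF exp_gt_zero])
        then have r: "r = exp v" by (simp add: v_def)
        then have v: "x n \<le> v" "v \<le> x (Suc n)" using that unfolding Rx by auto
        have "3 \<le> \<phi> (x n)" using x3[of "Suc n"] n by (simp add: xS)
        then have "3 \<le> \<phi> v" "\<phi> v \<le> x (Suc (Suc n))" using \<phi>_mono[OF v(1)] \<phi>_mono[OF v(2)] by (auto simp: xS)
        moreover have "1 \<le> v" using x3[OF n] v by simp
        ultimately have "ln (\<phi> v) / v \<le> ln (\<phi> v)" "ln (\<phi> v) \<le> ln (x (Suc (Suc n)))"
          by (auto simp: divide_le_eq mult_le_cancel_left1)
        then show ?thesis by (simp add: r M)
      qed
      then show "bdd_above ((\<lambda>r. ln (ln (max_mod f r)) / ln r) ` {?R n..?R (Suc n)})"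
        by (intro bdd_aboveI2)
    qed
    then show ?thesis by (simp add: M)
  qed
  have growth: "\<phi> y \<le> exp (a n * y)" if "n0 \<le> n" "x n \<le> y" "y \<le> x (Suc n)" for n y
  proof -
    have "0 < y" "0 < \<phi> y"
      using x3[OF that(1)] x3[of "Suc n"] \<phi>_mono[OF that(2)] that by (auto simp: xS)
    then have "ln (\<phi> y) \<le> a n * y" using a_ge[OF that] by (simp add: divide_le_eq)
    then have "exp (ln (\<phi> y)) \<le> exp (a n * y)" by simp
    then show ?thesis using \<open>0 < \<phi> y\<close> by simp
  qed
  \<comment> \<open>This allows additive constants to be charged to multiples of
    \<open>a n * x n\<close>.\<close>
  have a1: "1 \<le> a n * x n" if n: "n0 \<le> n" for n
  proof -
    have "exp 1 \<le> x (Suc n)"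
      using exp_le x3[of "Suc n"] n by simp
    then have "1 \<le> ln (\<phi> (x n))" by (simp add: xS ln_ge_iff less_le_trans[OF exp_gt_zero])
    then show ?thesis
      using a_ge[OF n, of "x n"] x_mono[of n "Suc n"] x3[OF n] by (simp add: divide_le_eq)
  qed
  then have a_pos: "0 < a n" if "n0 \<le> n" for n
    using that x3[OF that] by (smt (verit) mult_nonpos_nonneg)

  \<comment> \<open>Early terms, whose sign is not controlled, are set to 0 so that all tails are
    nonnegative.\<close>
  define b where "b n = (if n < n0 then 0 else a n)" for n
  have "summable a" using sum unfolding a_def .
  then have "summable b"
    by (rule summable_cong[THEN iffD1, rotated]) (auto simp: b_def eventually_sequentially intro!: exI[of _ n0])
  have b0: "0 \<le> b n" for n using a_pos[of n] by (auto simp: b_def)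
  define D where "D = ln 23 / ln (12 / 11 :: real)"
  have D: "0 < D" "0 < ln (23::real)" by (simp_all add: D_def)
  \<comment> \<open>Per unit of \<open>b n\<close>, \<open>2 * D + ln 23\<close> pays for the search
    for a circle, and \<open>\<bar>\<phi> 0\<bar> + 2\<close> for convexity and the loss of 2 in
    \<open>circle_step\<close>.\<close>
  define K where "K = 2 * D + ln 23 + \<bar>\<phi> 0\<bar> + 2"
  have K: "0 < K" using D unfolding K_def by linarith
  \<comment> \<open>The excess over 1 is \<open>K\<close> times a tail of the series: it tends to 0
    and drops by \<open>K * b n\<close> at each step.\<close>
  define c where "c n = 1 + K * (suminf b - (\<Sum>k<n. b k))" for n
  have c1: "1 \<le> c n" for n
    using sum_le_suminf[OF \<open>summable b\<close>, of "{..<n}"] b0 K by (simp add: c_def)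
  have cS: "c (Suc n) = c n - K * b n" for n by (simp add: c_def algebra_simps)
  have "c \<longlonglongrightarrow> 1 + K * (suminf b - suminf b)"
    unfolding c_def by (intro tendsto_intros summable_LIMSEQ \<open>summable b\<close>)
  then have "\<forall>\<^sub>F n in sequentially. c n < 2"
    by (intro order_tendstoD(2)) auto
  then obtain n1 where n1: "\<And>n. n1 \<le> n \<Longrightarrow> c n < 2" unfolding eventually_sequentially by blast
  define N where "N = max n0 n1"
  have "\<exists>t. exp (x n) \<le> t \<and> t \<le> exp (c n * x n) \<and> (\<forall>z. cmod z = t \<longrightarrow> exp (c (Suc n) * x (Suc n)) \<le> cmod (f z))"
    if "N \<le> n" for n
  proof -
    have n: "n0 \<le> n" "n1 \<le> n" using that by (auto simp: N_def)
    note xn = x3[OF n(1)] x2[OF n(1)] a1[OF n(1)] a_pos[OF n(1)]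
    have bn: "b n = a n" using n by (simp add: b_def)
    \<comment> \<open>From \<open>c n < 2\<close> and \<open>2 * x n \<le> x (Suc n)\<close>,
      \<open>y\<close> stays in the interval on which \<open>a n\<close> controls the
      growth.\<close>
    define y where "y = c n * x n"
    have "1 * x n \<le> c n * x n" "c n * x n \<le> 2 * x n"
      using c1[of n] n1[OF n(2)] xn by (auto intro!: mult_right_mono)
    then have y: "x n \<le> y" "y \<le> 2 * x n" "y \<le> x (Suc n)" "0 < y" using xn unfolding y_def by linarith+
    \<comment> \<open>The exponent left after the search for a circle; the rest of the drop to
      \<open>c (Suc n)\<close> is spent on convexity.\<close>
    define c' where "c' = c n - (2 * D + ln 23) * a n"
    have c': "c (Suc n) = c' - (\<bar>\<phi> 0\<bar> + 2) * a n"
      by (simp add: cS c'_def K_def bn algebra_simps)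
    have "0 \<le> (\<bar>\<phi> 0\<bar> + 2) * a n" "0 \<le> (2 * D + ln 23) * a n"
      using xn D by (auto intro!: mult_nonneg_nonneg add_nonneg_nonneg simp del: ln_ge_zero_iff)
    then have c'1: "1 \<le> c'" "c' \<le> 2" using c1[of "Suc n"] n1[OF n(2)] by (auto simp: c' c'_def)
    define \<sigma> where "\<sigma> = c' * x n"
    have "x n \<le> \<sigma>" using mult_right_mono[OF c'1(1), of "x n"] xn by (simp add: \<sigma>_def)
    have "D * (a n * y) \<le> D * (a n * (2 * x n))"
      using xn D y by (intro mult_left_mono) auto
    moreover have "ln 23 * 1 \<le> ln 23 * (a n * x n)" using xn by (intro mult_left_mono) auto
    moreover have "(a n * y / ln (12 / 11) + 1) * ln 23 = D * (a n * y) + ln 23"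
      by (simp add: D_def distrib_right)
    moreover have "\<sigma> = y - 2 * (D * (a n * x n)) - ln 23 * (a n * x n)"
      by (simp add: \<sigma>_def c'_def y_def algebra_simps)
    ultimately have \<sigma>: "\<sigma> \<le> y - (a n * y / ln (12 / 11) + 1) * ln 23"
      by argo
    have "3 \<le> \<phi> \<sigma>"
      using \<phi>_mono[OF \<open>x n \<le> \<sigma>\<close>] x3[of "Suc n"] n by (simp add: xS)
    then obtain t where t: "exp \<sigma> \<le> t" "t \<le> exp y" "\<And>z. cmod z = t \<Longrightarrow> exp (\<phi> \<sigma> - 2) \<le> cmod (f z)"
      using circle_step[OF f nc xn(4) y(4) _ \<sigma>] growth[OF n(1) y(1,3)] unfolding \<phi>_def by auto
    \<comment> \<open>Convexity transports the exponent: \<open>\<phi> (x n)\<close> is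
      \<open>x (Suc n)\<close>, and the error involves only \<open>\<phi> 0\<close>.\<close>
    have "c' * x (Suc n) \<le> \<phi> \<sigma> + (c' - 1) * \<phi> 0"
      using ln_max_mod_scale[OF f nc c'1(1), of "x n"] xn by (simp add: \<phi>_def xS \<sigma>_def)
    moreover have "(c' - 1) * \<phi> 0 \<le> 1 * \<bar>\<phi> 0\<bar>"
    proof (rule order_trans)
      show "(c' - 1) * \<phi> 0 \<le> (c' - 1) * \<bar>\<phi> 0\<bar>" using c'1 by (intro mult_left_mono) auto
      show "(c' - 1) * \<bar>\<phi> 0\<bar> \<le> 1 * \<bar>\<phi> 0\<bar>" using c'1 by (intro mult_right_mono) auto
    qed
    moreover have "(\<bar>\<phi> 0\<bar> + 2) * 1 \<le> (\<bar>\<phi> 0\<bar> + 2) * (a n * x (Suc n))"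
    proof (rule mult_left_mono)
      have "a n * x n \<le> a n * x (Suc n)" using x_mono[of n "Suc n"] xn by (intro mult_left_mono) auto
      then show "1 \<le> a n * x (Suc n)" using xn by linarith
    qed simp
    ultimately have "c (Suc n) * x (Suc n) \<le> \<phi> \<sigma> - 2"
      by (simp add: c' algebra_simps)
    then show ?thesis
      using t \<open>x n \<le> \<sigma>\<close> unfolding y_def
      by (intro exI[of _ t]) (auto intro: order_trans[OF iffD2[OF exp_le_cancel_iff]])
  qed
  then obtain \<rho> where \<rho>: "\<And>n. N \<le> n \<Longrightarrow> exp (x n) \<le> \<rho> n" "\<And>n. N \<le> n \<Longrightarrow> \<rho> n \<le> exp (c n * x n)"
    "\<And>n z. N \<le> n \<Longrightarrow> cmod z = \<rho> n \<Longrightarrow> exp (c (Suc n) * x (Suc n)) \<le> cmod (f z)"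
    by metis
  show thesis
  proof (rule that[of N \<rho>])
    show "?R n \<le> \<rho> n" if "N \<le> n" for n using \<rho>(1)[OF that] by (simp add: Rx)
    show "\<rho> (Suc n) \<le> cmod (f z)" if "N \<le> n" "cmod z = \<rho> n" for n z
      using \<rho>(2)[of "Suc n"] \<rho>(3)[OF that] that by simp
  qed
qed

section \<open>Topology of level sets\<close>

lemma max_principle_strict:
  fixes g :: "complex \<Rightarrow> complex"
  assumes g: "g holomorphic_on UNIV" and W: "bounded W"
    and fr: "\<And>z. z \<in> frontier W \<Longrightarrow> cmod (g z) < c" and z: "z \<in> W"
  shows "cmod (g z) < c"
proof -
  have cont: "continuous_on A g" for A
    using g holomorphic_on_imp_continuous_on continuous_on_subset by blast
  have mm: "cmod (g z) \<le> B" if "\<And>v. v \<in> frontier W \<Longrightarrow> cmod (g v) \<le> B" for B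
    using maximum_modulus_frontier[OF holomorphic_on_subset[OF g] cont W] that z by blast
  show ?thesis
  proof (cases "frontier W = {}")
    \<comment> \<open>With no frontier, even the bound \<open>- 1\<close> holds vacuously there,
      which is absurd.\<close>
    case True
    then show ?thesis using mm[of "- 1"] norm_ge_zero[of "g z"] by simp
  next
    case False
    then obtain v where v: "v \<in> frontier W" "\<And>u. u \<in> frontier W \<Longrightarrow> cmod (g u) \<le> cmod (g v)"
      using continuous_attains_sup[of "frontier W" "\<lambda>z. cmod (g z)"] cont compact_frontier_bounded[OF W]
      by (metis continuous_on_norm)
    then show ?thesis using mm[of "cmod (g v)"] fr[OF v(1)] by auto
  qed
qed

text \<open>The frontier of \<open>G\<close> is connected, so in any splitting one piece lies inside
  \<open>G\<close>. That piece has a neighbourhood whose frontier avoids the superlevel set, and the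
  maximum principle forces \<open>cmod (g z) < c\<close> on it.\<close>

lemma connected_superlevel_closure:
  fixes g :: "complex \<Rightarrow> complex"
  assumes g: "g holomorphic_on UNIV" and G: "open G" "bounded G" "simply_connected G"
    and fr: "frontier G \<subseteq> {z. c \<le> cmod (g z)}"
  shows "connected ({z. c \<le> cmod (g z)} \<inter> closure G)"
proof (rule ccontr)
  let ?E = "{z. c \<le> cmod (g z)}"
  have "continuous_on UNIV g" using g holomorphic_on_imp_continuous_on by blast
  then have "closed ?E" by (intro closed_Collect_le continuous_intros)
  then have clo: "closed (?E \<inter> closure G)" by (simp add: closed_Int)
  assume "\<not> ?thesis"
  then obtain A B where AB: "closed A" "closed B" "A \<noteq> {}" "B \<noteq> {}" "A \<union> B = ?E \<inter> closure G" "A \<inter> B = {}"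
    unfolding connected_closed_set[OF clo] by blast
  have frsub: "frontier G \<subseteq> A \<union> B"
    using fr AB(5) by (auto simp: frontier_def)
  have "connected (frontier G)"
    using simply_connected_eq_frontier_properties[OF G(1)] G by simp
  then have disj: "A \<inter> frontier G = {} \<or> B \<inter> frontier G = {}"
    using frsub AB connected_closedD[of "frontier G" A B] by auto
  have separated: False if "closed A" "closed B" "B \<noteq> {}" "A \<union> B = ?E \<inter> closure G" "A \<inter> B = {}" "B \<inter> frontier G = {}"
    for A B
  proof -
    have "B \<subseteq> G" using that frontier_def interior_open[OF G(1)] by fastforce
    then have "B \<inter> (A \<union> - G) = {}" "closed (A \<union> - G)"
      using that G by auto
    then obtain U V where UV: "open U" "open V" "B \<subseteq> U" "A \<union> - G \<subseteq> V" "U \<inter> V = {}"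
      using separation_normal[OF \<open>closed B\<close>] by metis
    then have cl: "closure U \<inter> V = {}" using open_Int_closure_eq_empty[of V U] by blast
    then have UG: "closure U \<subseteq> G" using UV(4) by blast
    have "bounded U" using bounded_subset[OF G(2)] UG closure_subset[of U] by blast
    moreover have "cmod (g z) < c" if "z \<in> frontier U" for z
    proof (rule ccontr)
      assume "\<not> ?thesis"
      moreover have z: "z \<in> closure U" "z \<notin> U" using that UV(1) by (auto simp: frontier_def interior_open)
      ultimately have "z \<in> A \<union> B" using UG \<open>A \<union> B = _\<close> closure_subset[of G] by auto
      then show False using z cl UV by blast
    qed
    ultimately have "cmod (g z) < c" if "z \<in> U" for z
      using max_principle_strict[OF g] that by blast
    moreover obtain v where "v \<in> B" using \<open>B \<noteq> {}\<close> by blast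
    ultimately show False using UV(3) \<open>A \<union> B = _\<close> by force
  qed
  have "B \<union> A = ?E \<inter> closure G" "B \<inter> A = {}" using AB(5,6) by blast+
  then show False
    using disj separated[OF AB(1,2,4,5,6)] separated[OF AB(2,1,3)] by blast
qed

text \<open>Within each \<open>closure (G n)\<close> the superlevel sets form a decreasing sequence
  of compact connected sets, so their intersection is connected; these intersections share a point
  and exhaust the whole set.\<close>

lemma connected_Inter_superlevels:
  fixes g :: "nat \<Rightarrow> complex \<Rightarrow> complex" and c :: "nat \<Rightarrow> real" and G :: "nat \<Rightarrow> complex set"
  defines "E \<equiv> \<lambda>k. {z. c k \<le> cmod (g k z)}"
  assumes g: "\<And>k. g k holomorphic_on UNIV" and dec: "\<And>k. E (Suc k) \<subseteq> E k"
    and G: "\<And>n. bounded (G n)" "\<And>n. open (G n)" "\<And>n. simply_connected (G n)"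
      "\<And>n. frontier (G n) \<subseteq> (\<Inter>k. E k)" "\<And>n. G n \<subseteq> G (Suc n)" "(\<Union>n. G n) = UNIV" "G 0 \<noteq> {}"
  shows "connected (\<Inter>k. E k)"
proof -
  have conn: "connected ((\<Inter>k. E k) \<inter> closure (G n))" for n
  proof -
    have "closed (E k)" for k
      unfolding E_def using g holomorphic_on_imp_continuous_on
      by (intro closed_Collect_le continuous_intros) auto
    then have "compact (E k \<inter> closure (G n))" for k
      using G(1) by (simp add: closed_Int_compact)
    moreover have "connected (E k \<inter> closure (G n))" for k
      unfolding E_def using G(4)[of n] by (intro connected_superlevel_closure g G) (auto simp: E_def)
    moreover have "E m \<inter> closure (G n) \<subseteq> E k \<inter> closure (G n)" if "k \<le> m" for k m
      using lift_Suc_antimono_le[of E, OF dec that] by blast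
    ultimately have "connected (\<Inter>k. E k \<inter> closure (G n))"
      by (rule connected_nest)
    then show ?thesis by (simp add: Int_commute)
  qed
  have "G 0 \<noteq> UNIV" using G(1) not_bounded_UNIV by metis
  then obtain w where w: "w \<in> frontier (G 0)"
    using G(7) frontier_eq_empty by blast
  have "w \<in> closure (G n)" for n
    using w lift_Suc_mono_le[of G 0 n, OF G(5)] closure_mono by (auto simp: frontier_def)
  then have "w \<in> (\<Inter>n. (\<Inter>k. E k) \<inter> closure (G n))" using w G(4) by blast
  then have "connected (\<Union>n. (\<Inter>k. E k) \<inter> closure (G n))"
    using conn by (intro connected_Union) blast+
  moreover have "UNIV \<subseteq> (\<Union>n. closure (G n))"
    unfolding G(6)[symmetric] by (intro UN_mono closure_subset order_refl)
  then have "(\<Union>n. (\<Inter>k. E k) \<inter> closure (G n)) = (\<Inter>k. E k)"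
    unfolding Int_UN_distrib[symmetric] by blast
  ultimately show ?thesis by simp
qed

section \<open>Simple connectivity of components of increasing unions\<close>

lemma compact_subset_increasing_Union:
  fixes V :: "nat \<Rightarrow> 'a :: topological_space set"
  assumes "compact S" "\<And>k. open (V k)" "\<And>k. V k \<subseteq> V (Suc k)" "S \<subseteq> (\<Union>k. V k)"
  obtains k where "S \<subseteq> V k"
proof -
  obtain C where C: "finite C" "S \<subseteq> (\<Union>k\<in>C. V k)"
    using compactE_image[OF assms(1), of UNIV V] assms by auto
  have "V k \<subseteq> V (Max (insert 0 C))" if "k \<in> C" for k
    using that C(1) by (intro lift_Suc_mono_le[of V, OF assms(3)]) auto
  then show thesis using that C(2) by blast
qed

text \<open>A loop in \<open>U\<close> is compact, so it lies in a single \<open>{z. cmod (g k z) < c k}\<close>, and by the maximum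
  principle so does everything it encloses.\<close>
lemma simply_connected_component_Union_sublevels:
  fixes g :: "nat \<Rightarrow> complex \<Rightarrow> complex" and c :: "nat \<Rightarrow> real"
  defines "V \<equiv> \<lambda>k. {z. cmod (g k z) < c k}"
  assumes g: "\<And>k. g k holomorphic_on UNIV" and inc: "\<And>k. V k \<subseteq> V (Suc k)"
  shows "simply_connected (connected_component_set (\<Union>k. V k) a)"
proof -
  let ?U = "connected_component_set (\<Union>k. V k) a"
  have opV: "open (V k)" for k
    unfolding V_def using g holomorphic_on_imp_continuous_on
    by (intro open_Collect_less continuous_intros) auto
  then have "open ?U" by (intro open_connected_component) auto
  moreover have "winding_number p z = 0"
    if p: "path p" "path_image p \<subseteq> ?U" "pathfinish p = pathstart p" and z: "z \<notin> ?U" for p z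
  proof (rule winding_number_zero_in_outside[OF p(1,3)], rule ccontr)
    let ?P = "path_image p"
    assume "z \<notin> outside ?P"
    moreover have "z \<notin> ?P" using p(2) z by blast
    ultimately have "z \<in> inside ?P" using inside_Un_outside[of ?P] by blast
    have "?P \<subseteq> (\<Union>k. V k)" using p(2) connected_component_subset by blast
    then obtain k where k: "?P \<subseteq> V k"
      using compact_subset_increasing_Union[of ?P V] compact_path_image[OF p(1)] opV inc by blast
    have "inside ?P \<subseteq> V k"
    proof
      fix v assume v: "v \<in> inside ?P"
      have "frontier (inside ?P) \<subseteq> V k"
        using frontier_inside_subset[OF closed_path_image[OF p(1)]] k by blast
      then show "v \<in> V k"
        using max_principle_strict[OF g bounded_inside[OF bounded_path_image[OF p(1)]] _ v, of k "c k"]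
        by (auto simp: V_def)
    qed
    \<comment> \<open>The loop and its inside form a connected subset of the union, so the enclosed
      point \<open>z\<close> would belong to the component.\<close>
    then have "?P \<union> inside ?P \<subseteq> (\<Union>k. V k)" using k by blast
    moreover have "connected (?P \<union> inside ?P)"
      by (intro connected_with_inside closed_path_image connected_path_image p)
    moreover have "pathstart p \<in> ?P" by auto
    ultimately have "z \<in> connected_component_set (\<Union>k. V k) (pathstart p)"
      using \<open>z \<in> inside ?P\<close> connected_component_maximal[of "pathstart p" "?P \<union> inside ?P" "\<Union>k. V k"] by auto
    moreover have "connected_component_set (\<Union>k. V k) (pathstart p) = ?U"
      using p(2) pathstart_in_path_image[of p] by (intro connected_component_eq) blast
    ultimately show False using z by simp
  qed
  ultimately show ?thesis
    by (subst simply_connected_eq_winding_number_zero) (auto simp: connected_connected_component)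
qed

section \<open>The spider's web\<close>

lemma holomorphic_on_funpow:
  assumes "f holomorphic_on UNIV"
  shows "(f ^^ n) holomorphic_on UNIV"
proof (induction n)
  case (Suc n)
  then show ?case
    using holomorphic_on_compose_gen[OF Suc.IH assms] by (simp add: o_def)
qed (simp add: holomorphic_on_ident[unfolded id_def[symmetric]])

definition superlevel :: "(complex \<Rightarrow> complex) \<Rightarrow> real \<Rightarrow> nat \<Rightarrow> complex set" where
  "superlevel f s k = {z. (max_mod f ^^ k) s \<le> cmod ((f ^^ k) z)}"

context
  fixes f :: "complex \<Rightarrow> complex"
  assumes f: "f holomorphic_on UNIV" and nc: "\<not> f constant_on UNIV"
begin

lemma continuous_on_norm_funpow: "continuous_on A (\<lambda>z. cmod ((f ^^ k) z))"
  by (intro continuous_on_norm holomorphic_on_imp_continuous_on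
      holomorphic_on_subset[OF holomorphic_on_funpow[OF f]] subset_UNIV)

text \<open>The strict maximum principle is what preserves strict inequality; it makes the
  complement of a level set an increasing union.\<close>

lemma sublevel_Suc:
  "{z. cmod ((f ^^ k) z) < (max_mod f ^^ k) s} \<subseteq> {z. cmod ((f ^^ Suc k) z) < (max_mod f ^^ Suc k) s}"
  using norm_less_max_mod[OF f nc] by auto

lemma ball_subset_sublevel: "ball 0 s \<subseteq> {z. cmod ((f ^^ k) z) < (max_mod f ^^ k) s}"
proof (induction k)
  case (Suc k)
  then show ?case using sublevel_Suc by (rule subset_trans)
qed auto

lemma superlevel_Suc: "superlevel f s (Suc k) \<subseteq> superlevel f s k"
proof -
  have "superlevel f s k = - {z. cmod ((f ^^ k) z) < (max_mod f ^^ k) s}" for k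
    by (auto simp: superlevel_def)
  then show ?thesis using sublevel_Suc[of k s] by (simp only: Compl_subset_Compl_iff)
qed

text \<open>The level set starts at index 1, the intersection at 0; the condition at 0 follows from
  the one at 1 because the superlevel sets decrease.\<close>

lemma fast_escaping_level_eq: "fast_escaping_level f s = (\<Inter>k. superlevel f s k)"
proof (intro equalityI subsetI INT_I)
  fix z k assume "z \<in> fast_escaping_level f s"
  then have "z \<in> superlevel f s (Suc k)"
    unfolding fast_escaping_level_def superlevel_def by (simp del: funpow.simps)
  then show "z \<in> superlevel f s k" using superlevel_Suc by blast
next
  fix z assume "z \<in> (\<Inter>k. superlevel f s k)"
  then show "z \<in> fast_escaping_level f s"
    unfolding fast_escaping_level_def superlevel_def by simp
qed

lemma closed_fast_escaping_level: "closed (fast_escaping_level f s)"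
proof -
  have "closed (superlevel f s k)" for k
    unfolding superlevel_def
    by (rule closed_Collect_le[OF continuous_on_const continuous_on_norm_funpow])
  then show ?thesis unfolding fast_escaping_level_eq by (intro closed_INT) auto
qed

lemma Compl_fast_escaping_level:
  "- fast_escaping_level f s = (\<Union>k. {z. cmod ((f ^^ k) z) < (max_mod f ^^ k) s})"
  unfolding fast_escaping_level_eq superlevel_def by (auto simp: not_le)

text \<open>The image of an arc from 0 to the circle of radius \<open>\<rho> 0\<close> under the \<open>k\<close>-th iterate still
  crosses the circle of radius \<open>\<rho> k\<close>, so the arc cannot stay in any of the sublevel sets.\<close>
lemma component_subset_ball:
  assumes s: "0 < s" and \<rho>: "\<And>k. (max_mod f ^^ k) s \<le> \<rho> k"
    and step: "\<And>k z. cmod z = \<rho> k \<Longrightarrow> \<rho> (Suc k) \<le> cmod (f z)"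
  shows "connected_component_set (- fast_escaping_level f s) 0 \<subseteq> ball 0 (\<rho> 0)"
proof (rule ccontr)
  let ?V = "\<lambda>k. {z. cmod ((f ^^ k) z) < (max_mod f ^^ k) s}"
  let ?U = "connected_component_set (- fast_escaping_level f s) 0"
  have V0: "0 \<in> ?V k" for k
    using subsetD[OF ball_subset_sublevel, of 0 s k] s by simp
  assume "\<not> ?thesis"
  then obtain z where z: "z \<in> ?U" "\<not> cmod z < \<rho> 0"
    unfolding subset_iff mem_ball_0 by blast
  have opn: "open (- fast_escaping_level f s)" using closed_fast_escaping_level by blast
  then have "open ?U" by (rule open_connected_component)
  then have "path_connected ?U"
    by (simp add: connected_open_path_connected)
  moreover have "0 \<in> ?U"
    using V0[of 0] unfolding connected_component_refl_eq mem_Collect_eq Compl_fast_escaping_level by blast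
  ultimately obtain p where p: "path p" "path_image p \<subseteq> ?U" "pathstart p = 0" "pathfinish p = z"
    using z(1) unfolding path_connected_def by blast
  let ?P = "path_image p"
  have P: "0 \<in> ?P" "z \<in> ?P" "connected ?P" "compact ?P"
    using p pathstart_in_path_image[of p] pathfinish_in_path_image[of p]
    by (auto simp: connected_path_image compact_path_image)
  have "?P \<subseteq> (\<Union>k. ?V k)"
    using p(2) connected_component_subset unfolding Compl_fast_escaping_level[symmetric] by blast
  moreover have "open (?V k)" for k
    by (rule open_Collect_less[OF continuous_on_norm_funpow continuous_on_const])
  ultimately obtain k where k: "?P \<subseteq> ?V k"
    using compact_subset_increasing_Union[OF P(4), of ?V, OF _ sublevel_Suc] by metis
  have "\<exists>w\<in>?P. \<rho> j \<le> cmod ((f ^^ j) w)" for j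
  proof (induction j)
    case 0
    then show ?case using P z by (intro bexI[of _ z]) auto
  next
    case (Suc j)
    then obtain w where w: "w \<in> ?P" "\<rho> j \<le> cmod ((f ^^ j) w)" by blast
    have "cmod ((f ^^ j) 0) \<le> \<rho> j"
      using V0[of j] \<rho>[of j] by simp
    moreover have "connected ((\<lambda>z. cmod ((f ^^ j) z)) ` ?P)"
      by (intro connected_continuous_image continuous_on_norm_funpow P(3))
    \<comment> \<open>Intermediate values: along the arc the modulus goes from at most
      \<open>\<rho> j\<close> at 0 to at least \<open>\<rho> j\<close> at \<open>w\<close>.\<close>
    ultimately have "\<rho> j \<in> (\<lambda>z. cmod ((f ^^ j) z)) ` ?P"
      using connectedD_interval[OF _ imageI[OF P(1)] imageI[OF w(1)]] w(2) by blast
    then obtain v where v: "v \<in> ?P" "cmod ((f ^^ j) v) = \<rho> j" by auto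
    then show ?case using step[of "(f ^^ j) v" j] by (intro bexI[of _ v]) auto
  qed
  then obtain w where w: "w \<in> ?P" "\<rho> k \<le> cmod ((f ^^ k) w)" by blast
  then have "cmod ((f ^^ k) w) < (max_mod f ^^ k) s" using k by blast
  then show False using w(2) \<rho>[of k] by linarith
qed

end

theorem theorem1:
  fixes f :: "complex \<Rightarrow> complex" and R :: real
  assumes "transcendental_entire f"
    and "R > 0"
    and "\<forall>r\<ge>R. max_mod f r > r"
    and "summable (\<lambda>n::nat.
           SUP r\<in>{(max_mod f ^^ (Suc n)) R .. (max_mod f ^^ (Suc (Suc n))) R}.
             ln (ln (max_mod f r)) / ln r)"
  shows "spiders_web (fast_escaping_level f R)"
proof -
  have f: "f holomorphic_on UNIV" using assms(1) by (simp add: transcendental_entire_def)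
  note nc = transcendental_not_constant[OF assms(1)]
  let ?R = "\<lambda>n. (max_mod f ^^ n) R"
  \<comment> \<open>The hypothesis sums from index 1; adding the term at 0 does not affect
    convergence.\<close>
  have "summable (\<lambda>n. SUP r\<in>{?R n .. ?R (Suc n)}. ln (ln (max_mod f r)) / ln r)"
    using assms(4) by (subst summable_Suc_iff[symmetric])
  from exists_radii[OF assms(1-3) this] obtain N \<rho> where \<rho>: "\<And>n. N \<le> n \<Longrightarrow> ?R n \<le> \<rho> n"
    "\<And>n z. N \<le> n \<Longrightarrow> cmod z = \<rho> n \<Longrightarrow> \<rho> (Suc n) \<le> cmod (f z)"
    by blast
  have R0: "0 < ?R n" for n
    using iterate_ge[OF f assms(2,3), of n] assms(2) by linarith
  have add: "(max_mod f ^^ k) (?R n) = ?R (k + n)" for k n by (simp add: funpow_add)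
  note inc = incseqD[OF incseq_iterate[OF f assms(2,3)]]
  have level_mono: "fast_escaping_level f (?R m) \<subseteq> fast_escaping_level f (?R n)" if "n \<le> m" for n m
  proof -
    have "?R (k + n) \<le> ?R (k + m)" for k using that by (intro inc) simp
    then show ?thesis
      unfolding fast_escaping_level_def add by (auto intro: order_trans)
  qed
  \<comment> \<open>Indices start at \<open>N\<close>, where the radii become available;
    \<open>level_mono\<close> still places the frontiers in the level set of
    \<open>R\<close>.\<close>
  define G where "G n = connected_component_set (- fast_escaping_level f (?R (N + n))) 0" for n
  have ball: "ball 0 (?R (N + n)) \<subseteq> G n" for n
  proof -
    have "ball 0 (?R (N + n)) \<subseteq> - fast_escaping_level f (?R (N + n))"
      unfolding Compl_fast_escaping_level[OF f nc] using ball_subset_sublevel[OF f nc] by blast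
    then show ?thesis unfolding G_def
      using R0 by (intro connected_component_maximal) auto
  qed
  have G: "bounded (G n)" "open (G n)" "connected (G n)" "simply_connected (G n)"
    "frontier (G n) \<subseteq> fast_escaping_level f R" "G n \<subseteq> G (Suc n)" for n
  proof -
    have "G n \<subseteq> ball 0 (\<rho> (N + n + 0))"
      unfolding G_def
    proof (rule component_subset_ball[OF f nc R0])
      show "(max_mod f ^^ k) (?R (N + n)) \<le> \<rho> (N + n + k)" for k
        unfolding add using \<rho>(1)[of "N + n + k"] by (simp add: ac_simps)
    qed (use \<rho>(2) in simp)
    then show "bounded (G n)" using bounded_ball bounded_subset by blast
    show "open (G n)" unfolding G_def
      using closed_fast_escaping_level[OF f nc] by (intro open_connected_component) blast
    show "connected (G n)" by (simp add: G_def)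
    show "simply_connected (G n)"
      unfolding G_def Compl_fast_escaping_level[OF f nc]
      by (rule simply_connected_component_Union_sublevels[of "\<lambda>k. f ^^ k"])
        (rule holomorphic_on_funpow[OF f] sublevel_Suc[OF f nc])+
    have "frontier (G n) \<subseteq> frontier (- fast_escaping_level f (?R (N + n)))"
      unfolding G_def by (rule frontier_of_connected_component_subset)
    also have "\<dots> \<subseteq> fast_escaping_level f (?R (N + n))"
      using closed_fast_escaping_level[OF f nc] by (simp add: frontier_complement frontier_subset_closed)
    also have "\<dots> \<subseteq> fast_escaping_level f R" using level_mono[of 0 "N + n"] by simp
    finally show "frontier (G n) \<subseteq> fast_escaping_level f R" .
    show "G n \<subseteq> G (Suc n)"
      unfolding G_def using level_mono[of "N + n" "N + Suc n"] by (intro connected_component_mono) auto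
  qed
  have UN: "(\<Union>n. G n) = UNIV"
  proof -
    have "z \<in> (\<Union>n. G n)" for z
    proof -
      have "\<forall>\<^sub>F n in sequentially. cmod z < ?R n"
        using iterate_at_top[OF f assms(2,3)] unfolding filterlim_at_top_dense by blast
      then obtain n where "cmod z < ?R n"
        unfolding eventually_sequentially by blast
      moreover have "?R n \<le> ?R (N + n)" by (intro inc) simp
      ultimately have "z \<in> ball 0 (?R (N + n))" by simp
      then show ?thesis using ball by blast
    qed
    then show ?thesis by blast
  qed
  have "connected (fast_escaping_level f R)"
    unfolding fast_escaping_level_eq[OF f nc] superlevel_def
  proof (rule connected_Inter_superlevels[of "\<lambda>k. f ^^ k" "\<lambda>k. (max_mod f ^^ k) R" G])
    show "(f ^^ k) holomorphic_on UNIV" for k by (rule holomorphic_on_funpow[OF f])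
    show "G 0 \<noteq> {}" using ball[of 0] R0[of "N + 0"] by force
    show "{z. (max_mod f ^^ Suc k) R \<le> cmod ((f ^^ Suc k) z)} \<subseteq> {z. (max_mod f ^^ k) R \<le> cmod ((f ^^ k) z)}" for k
      using superlevel_Suc[OF f nc] unfolding superlevel_def .
    show "frontier (G n) \<subseteq> (\<Inter>k. {z. (max_mod f ^^ k) R \<le> cmod ((f ^^ k) z)})" for n
      using G(5)[of n] unfolding fast_escaping_level_eq[OF f nc] superlevel_def .
  qed (rule G UN)+
  then show ?thesis
    unfolding spiders_web_def by (intro conjI exI[of _ G] allI G UN)
qed

end
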